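(* For every $t\in\mathbb{R}$ let $X_t$ be a nonempty subset of $\mathbb{R}$. Then there exists a family $(Y_t)_{t\in\mathbb{R}}$ of nowhere dense Lebesgue null sets $Y_t\subset\mathbb{R}$, with $Y_s\cap Y_t=\emptyset$ whenever $s\neq t$ and $\bigcup_{t\in\mathbb{R}}Y_t=\mathbb{R}$ (so $\{Y_t \mid t\in\mathbb{R}\}$ is a partition of $\mathbb{R}$), such that for every $t\in\mathbb{R}$ there is an increasing bijection $\varphi_t$ from $X_t$ onto $Y_t$, and $\varphi_t$ is a homeomorphism from $X_t$ onto $Y_t$ in case that $X_t$ is totally disconnected.
   Context: All subsets of $\mathbb{R}$ carry the subspace topology of the usual topology of $\mathbb{R}$. A subset of $\mathbb{R}$ is totally disconnected if and only if it contains no nondegenerate interval. *)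

theory Defs
  imports "HOL-Analysis.Analysis"
begin

definition nowhere_dense :: "'a::topological_space set \<Rightarrow> bool" where
  "nowhere_dense S \<longleftrightarrow> interior (closure S) = {}"

definition totally_disconnected :: "'a::topological_space set \<Rightarrow> bool" where
  "totally_disconnected S \<longleftrightarrow> (\<forall>x\<in>S. connected_component_set S x = {x})"

end

(* For every parameter s there is a family of increasing step-function series
   x |-> sum of 10^-i over the positions i in a pattern P_s whose jump point d_i lies below x, where
   (d_i) is a dense sequence. Such a map is strictly increasing with values in a null Cantor set, and
   on a set missing all jump points it is a homeomorphism onto its image; a totally disconnected X_t
   has a dense complement, so the jump points can be taken there.
   The patterns are chosen so that the sets V_s of differences of values are independent: an equation
   v - v' = a - a' with v in V_s, v' in V_s', a, a' in V_r and s distinct from s' and r forces v = 0.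
   Hence a transfinite recursion of length continuum can place the sets Y_t = p_t + (subset of V_s
   containing 0) one at a time: the point p_t is chosen uncovered, and then each of the fewer than
   continuum many earlier sets rules out at most two values of s, since v - v' = a - a' follows when
   both p_t + v and p_t + v' lie in the same earlier translate. *)

theory Submission
  imports Defs
begin

section \<open>Decimal series with small integer digits\<close>

text \<open>Signed digits are allowed so that differences of such series are again such
  series.\<close>

definition dec :: "(nat \<Rightarrow> int) \<Rightarrow> real" where
  "dec \<delta> = (\<Sum>i. of_int (\<delta> i) / 10 ^ i)"

lemma summable_const_div_power10: "summable (\<lambda>i. c / 10 ^ i :: real)"
  using summable_mult[OF summable_geometric[of "1/10 :: real"], of c]
  by (simp add: power_divide)

lemma suminf_const_div_power10: "(\<Sum>i. c / 10 ^ i :: real) = c * 10 / 9"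
  using suminf_mult[OF summable_geometric[of "1/10 :: real"], of c] suminf_geometric[of "1/10 :: real"]
  by (simp add: power_divide)

lemma summable_dec:
  assumes "\<And>i. \<bar>\<delta> i\<bar> \<le> (B::int)"
  shows "summable (\<lambda>i. of_int (\<delta> i) / 10 ^ i :: real)"
proof (rule summable_comparison_test')
  show "summable (\<lambda>i. of_int B / 10 ^ i :: real)" by (rule summable_const_div_power10)
  show "norm (of_int (\<delta> n) / 10 ^ n :: real) \<le> of_int B / 10 ^ n" if "n \<ge> 0" for n
    using assms[of n] by (simp add: divide_right_mono flip: of_int_abs)
qed

lemma abs_dec_le:
  assumes "\<And>i. \<bar>\<delta> i\<bar> \<le> (B::int)"
  shows "\<bar>dec \<delta>\<bar> \<le> of_int B * 10 / 9"
proof -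
  have le: "norm (of_int (\<delta> n) / 10 ^ n :: real) \<le> of_int B / 10 ^ n" for n
    using assms[of n] by (simp add: divide_right_mono flip: of_int_abs)
  have "norm (dec \<delta>) \<le> (\<Sum>i. of_int B / 10 ^ i)"
    unfolding dec_def by (rule norm_suminf_le[OF le summable_const_div_power10])
  then show ?thesis by (simp add: suminf_const_div_power10)
qed

lemma dec_diff:
  assumes "\<And>i. \<bar>\<delta> i\<bar> \<le> (B::int)" "\<And>i. \<bar>\<eta> i\<bar> \<le> (C::int)"
  shows "dec (\<lambda>i. \<delta> i - \<eta> i) = dec \<delta> - dec \<eta>"
  unfolding dec_def
  by (subst suminf_diff[OF summable_dec[OF assms(1)] summable_dec[OF assms(2)]])
     (simp add: diff_divide_distrib)

lemma dec_shift:
  assumes "\<And>i. \<bar>\<delta> i\<bar> \<le> (B::int)"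
  shows "dec \<delta> = of_int (\<delta> 0) + dec (\<lambda>i. \<delta> (Suc i)) / 10"
proof -
  have s: "summable (\<lambda>i. of_int (\<delta> (Suc i)) / 10 ^ i :: real)"
    by (rule summable_dec) (rule assms)
  have "dec \<delta> = (\<Sum>i. of_int (\<delta> (Suc i)) / 10 ^ Suc i) + of_int (\<delta> 0)"
    unfolding dec_def using suminf_split_head[OF summable_dec[of \<delta> B, OF assms]] by simp
  also have "(\<Sum>i. of_int (\<delta> (Suc i)) / 10 ^ Suc i :: real) = dec (\<lambda>i. \<delta> (Suc i)) / 10"
    unfolding dec_def by (subst suminf_divide[OF s, symmetric]) (simp add: mult.commute)
  finally show ?thesis by simp
qed

text \<open>The digits after the leading one contribute at most (4 * 10/9) / 10 < 1, so the integer
  leading digit vanishes; shift and repeat. The bound 4 fits a combination of four patterns with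
  digits in {-1, 0, 1}.\<close>

lemma dec_eq_0_imp:
  assumes "\<And>i. \<bar>\<delta> i\<bar> \<le> (4::int)" "dec \<delta> = 0"
  shows "\<delta> n = 0"
  using assms
proof (induction n arbitrary: \<delta>)
  case (0 \<delta>)
  have "\<bar>dec (\<lambda>i. \<delta> (Suc i))\<bar> \<le> of_int 4 * 10 / 9"
    by (rule abs_dec_le) (rule 0)
  then have "\<bar>of_int (\<delta> 0) :: real\<bar> < 1"
    using dec_shift[of \<delta> 4, OF 0(1)] 0(2) by linarith
  then show ?case by linarith
next
  case (Suc n \<delta>)
  have "\<bar>dec (\<lambda>i. \<delta> (Suc i))\<bar> \<le> of_int 4 * 10 / 9"
    by (rule abs_dec_le) (rule Suc)
  then have "\<bar>of_int (\<delta> 0) :: real\<bar> < 1"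
    using dec_shift[of \<delta> 4, OF Suc(2)] Suc(3) by linarith
  then have "\<delta> 0 = 0" by linarith
  then have "dec (\<lambda>i. \<delta> (Suc i)) = 0"
    using dec_shift[of \<delta> 4, OF Suc(2)] Suc(3) by simp
  then show ?case
    using Suc.IH[of "\<lambda>i. \<delta> (Suc i)"] Suc.prems(1) by simp
qed

section \<open>The null Cantor set of decimal digits 0 and 1\<close>

definition cantor10 :: "real set" where
  "cantor10 = dec ` {\<delta>. \<forall>i. \<delta> i \<in> {0, 1}}"

text \<open>Self-similarity: the compact set \<open>K = closure cantor10\<close> is covered by two copies of \<open>K\<close>
  scaled by 1/10, so its measure \<open>m\<close> satisfies \<open>m \<le> m / 5\<close>.\<close>
lemma negligible_closure_cantor10: "negligible (closure cantor10)"
proof -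
  let ?K = "closure cantor10"
  let ?f = "\<lambda>c x. (1/10) *\<^sub>R x + c :: real"
  have "bounded cantor10"
    unfolding bounded_iff cantor10_def
  proof (intro exI[of _ "10/9"] ballI)
    fix x assume "x \<in> dec ` {\<delta>. \<forall>i. \<delta> i \<in> {0, 1}}"
    then obtain \<delta> where \<delta>: "\<And>i. \<delta> i \<in> {0, 1::int}" "x = dec \<delta>" by auto
    have "\<bar>\<delta> i\<bar> \<le> 1" for i using \<delta>(1)[of i] by auto
    from abs_dec_le[OF this] show "norm x \<le> 10 / 9" by (simp add: \<delta>(2))
  qed
  then have K: "compact ?K" by simp
  have KM: "compact (?f c ` ?K)" for c
    by (intro compact_continuous_image continuous_intros K)
  have "cantor10 \<subseteq> ?f 0 ` ?K \<union> ?f 1 ` ?K"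
  proof
    fix x assume "x \<in> cantor10"
    then obtain \<delta> where \<delta>: "\<And>i. \<delta> i \<in> {0, 1::int}" "x = dec \<delta>"
      unfolding cantor10_def by auto
    have b: "\<bar>\<delta> i\<bar> \<le> 1" for i using \<delta>(1)[of i] by auto
    have "dec (\<lambda>i. \<delta> (Suc i)) \<in> cantor10"
      unfolding cantor10_def using \<delta>(1) by blast
    then have "dec (\<lambda>i. \<delta> (Suc i)) \<in> ?K" using closure_subset by blast
    moreover have "x = ?f (of_int (\<delta> 0)) (dec (\<lambda>i. \<delta> (Suc i)))"
      using dec_shift[of \<delta> 1, OF b] \<delta>(2) by simp
    ultimately have "x \<in> ?f (of_int (\<delta> 0)) ` ?K" by blast
    moreover have "\<delta> 0 = 0 \<or> \<delta> 0 = 1" using \<delta>(1)[of 0] by blast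
    ultimately show "x \<in> ?f 0 ` ?K \<union> ?f 1 ` ?K" by auto
  qed
  then have sub: "?K \<subseteq> ?f 0 ` ?K \<union> ?f 1 ` ?K"
    by (intro closure_minimal closed_Un compact_imp_closed KM)
  have "measure lebesgue ?K \<le> measure lebesgue (?f 0 ` ?K \<union> ?f 1 ` ?K)"
    by (intro measure_mono_fmeasurable sub fmeasurable.Un lmeasurable_compact KM)
       (use K lmeasurable_compact in blast)
  also have "\<dots> \<le> measure lebesgue (?f 0 ` ?K) + measure lebesgue (?f 1 ` ?K)"
    by (intro measure_Un_le fmeasurableD lmeasurable_compact KM)
  also have "\<dots> = measure lebesgue ?K / 5"
    unfolding measure_lebesgue_affine by simp
  finally have "measure lebesgue ?K = 0"
    using measure_nonneg[of lebesgue ?K] by linarith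
  then show ?thesis
    using lmeasurable_compact[OF K] by (simp add: negligible_iff_measure)
qed

text \<open>Both claims come from the closure of S being null: its interior is then a null open set,
  hence empty.\<close>

lemma translate_subset_cantor10:
  assumes "S \<subseteq> (+) c ` cantor10"
  shows "nowhere_dense S" "S \<in> null_sets lebesgue"
proof -
  have "closure S \<subseteq> (+) c ` closure cantor10"
    using closure_mono[OF assms] by (simp add: closure_translation)
  then have n: "negligible (closure S)"
    using negligible_translation[OF negligible_closure_cantor10] negligible_subset by blast
  then have "negligible (interior (closure S))"
    using interior_subset negligible_subset by blast
  then show "nowhere_dense S"
    unfolding nowhere_dense_def using open_not_negligible[OF open_interior] by blast
  have "negligible S" using n closure_subset negligible_subset by blast
  then show "S \<in> null_sets lebesgue" by (simp add: negligible_iff_null_sets)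
qed

section \<open>Independent families of digit patterns\<close>

text \<open>Position \<open>to_nat (n, k, z)\<close> belongs to the pattern of the parameter \<open>s\<close> iff \<open>z = \<lfloor>k s\<rfloor>\<close>, and
  then carries the digit \<open>\<epsilon> n\<close>. Patterns of different parameters share, for each \<open>n\<close>, only
  finitely many positions, while every \<open>\<epsilon> n\<close> is repeated infinitely often.\<close>
definition pattern :: "real \<Rightarrow> (nat \<Rightarrow> int) \<Rightarrow> nat \<Rightarrow> int" where
  "pattern s \<epsilon> i = (case from_nat i of (n::nat, k::nat, z::int) \<Rightarrow>
     if z = \<lfloor>real k * s\<rfloor> then \<epsilon> n else 0)"

lemma pattern_to_nat [simp]:
  "pattern s \<epsilon> (to_nat (n::nat, k::nat, z::int)) = (if z = \<lfloor>real k * s\<rfloor> then \<epsilon> n else 0)"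
  by (simp add: pattern_def)

lemma abs_pattern_le:
  assumes "\<And>n. \<bar>\<epsilon> n\<bar> \<le> 1"
  shows "\<bar>pattern s \<epsilon> i\<bar> \<le> 1"
  using assms by (auto simp: pattern_def split: prod.splits)

text \<open>Digits in {-1, 0, 1} arise as differences of two 0/1 patterns, so all differences of
  values of \<open>jump d s\<close> lie here.\<close>

definition span_pattern :: "real \<Rightarrow> real set" where
  "span_pattern s = {dec (pattern s \<epsilon>) | \<epsilon>. \<forall>n. \<bar>\<epsilon> n\<bar> \<le> 1}"

text \<open>Once k |s - t| \<ge> 1, the products are too far apart to share a floor. This yields
  positions of one pattern outside another.\<close>

lemma floor_mult_separates:
  fixes s t :: real
  assumes "s \<noteq> t" "k \<ge> nat \<lceil>1 / \<bar>s - t\<bar>\<rceil>"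
  shows "\<lfloor>real k * s\<rfloor> \<noteq> \<lfloor>real k * t\<rfloor>"
proof
  assume "\<lfloor>real k * s\<rfloor> = \<lfloor>real k * t\<rfloor>"
  then have "\<bar>real k * s - real k * t\<bar> < 1" by linarith
  moreover have "1 / \<bar>s - t\<bar> \<le> real k" using assms(2) by linarith
  then have "1 \<le> real k * \<bar>s - t\<bar>" using assms(1) by (simp add: divide_le_eq)
  then have "1 \<le> \<bar>real k * s - real k * t\<bar>" by (simp add: abs_mult flip: right_diff_distrib)
  ultimately show False by linarith
qed

text \<open>By \<open>dec_eq_0_imp\<close> the equation holds digit by digit. Each
  \<open>e1 n\<close> also sits at a position outside the patterns of \<open>s2\<close> and
  \<open>t\<close>, where the equation reads \<open>e1 n = 0\<close>.\<close>

lemma span_pattern_independent: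
  assumes "s1 \<noteq> s2" "s1 \<noteq> t"
    and "v1 \<in> span_pattern s1" "v2 \<in> span_pattern s2" "a1 \<in> span_pattern t" "a2 \<in> span_pattern t"
    and eq: "v1 - v2 = a1 - a2"
  shows "v1 = 0"
proof -
  obtain e1 e2 f1 f2 where
    v: "v1 = dec (pattern s1 e1)" "v2 = dec (pattern s2 e2)"
       "a1 = dec (pattern t f1)" "a2 = dec (pattern t f2)" and
    e: "\<And>n. \<bar>e1 n\<bar> \<le> 1" "\<And>n. \<bar>e2 n\<bar> \<le> 1" "\<And>n. \<bar>f1 n\<bar> \<le> 1" "\<And>n. \<bar>f2 n\<bar> \<le> 1"
    using assms(3-6) unfolding span_pattern_def by blast
  have b: "\<bar>pattern s1 e1 i\<bar> \<le> 1" "\<bar>pattern s2 e2 i\<bar> \<le> 1"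
    "\<bar>pattern t f1 i\<bar> \<le> 1" "\<bar>pattern t f2 i\<bar> \<le> 1" for i
    by (rule abs_pattern_le, rule e)+
  define p where "p i = pattern s1 e1 i - pattern s2 e2 i" for i
  define q where "q i = pattern t f1 i - pattern t f2 i" for i
  have pb: "\<bar>p i\<bar> \<le> 2" and qb: "\<bar>q i\<bar> \<le> 2" for i
    using b[of i] unfolding p_def q_def by linarith+
  have "dec (\<lambda>i. p i - q i) = dec p - dec q"
    by (rule dec_diff[OF pb qb])
  also have "dec p = v1 - v2" unfolding p_def v by (rule dec_diff[OF b(1,2)])
  also have "dec q = a1 - a2" unfolding q_def v by (rule dec_diff[OF b(3,4)])
  finally have z: "dec (\<lambda>i. p i - q i) = 0" using eq by simp
  have pq: "p i - q i = 0" for i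
  proof (rule dec_eq_0_imp[OF _ z])
    show "\<bar>p i - q i\<bar> \<le> 4" for i using pb[of i] qb[of i] by linarith
  qed
  have "e1 n = 0" for n
  proof -
    define k where "k = max (nat \<lceil>1 / \<bar>s1 - s2\<bar>\<rceil>) (nat \<lceil>1 / \<bar>s1 - t\<bar>\<rceil>)"
    have "\<lfloor>real k * s1\<rfloor> \<noteq> \<lfloor>real k * s2\<rfloor>" "\<lfloor>real k * s1\<rfloor> \<noteq> \<lfloor>real k * t\<rfloor>"
      by (rule floor_mult_separates; use assms(1,2) in \<open>simp add: k_def\<close>)+
    then show ?thesis
      using pq[of "to_nat (n, k, \<lfloor>real k * s1\<rfloor>)"] by (simp add: p_def q_def)
  qed
  then have "pattern s1 e1 = (\<lambda>_. 0)"
    by (auto simp: pattern_def fun_eq_iff split: prod.splits)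
  then show ?thesis by (simp add: v dec_def)
qed

lemma span_pattern_nonzero: "\<exists>v\<in>span_pattern s. v \<noteq> 0"
proof
  let ?v = "dec (pattern s (\<lambda>_. 1))"
  show "?v \<in> span_pattern s" unfolding span_pattern_def by force
  have "\<bar>pattern s (\<lambda>_. 1) i\<bar> \<le> 4" for i
    using abs_pattern_le[of "\<lambda>_. 1" s i] by simp
  \<comment> \<open>Position (0, 0, 0) lies in every pattern, because
    \<open>\<lfloor>0 * s\<rfloor> = 0\<close>.\<close>
  moreover have "pattern s (\<lambda>_. 1) (to_nat (0::nat, 0::nat, 0::int)) \<noteq> 0" by simp
  ultimately show "?v \<noteq> 0" using dec_eq_0_imp by blast
qed

text \<open>Each index excludes at most two parameters: \<open>s u\<close> itself, and, by independence, at most one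
  \<open>\<sigma>\<close> with a nonzero \<open>v\<close> such that \<open>q + v \<in> p u + span_pattern (s u)\<close>.\<close>
lemma fresh_parameter:
  includes cardinal_syntax
  fixes p s :: "'i \<Rightarrow> real"
  assumes I: "|I| <o |UNIV :: real set|"
  shows "\<exists>\<sigma>. \<forall>u\<in>I. \<forall>v\<in>span_pattern \<sigma>. \<forall>a\<in>span_pattern (s u). q + v = p u + a \<longrightarrow> v = 0"
proof -
  define bad where "bad u \<sigma> \<longleftrightarrow> \<sigma> \<noteq> s u \<and>
    (\<exists>v\<in>span_pattern \<sigma>. \<exists>a\<in>span_pattern (s u). q + v = p u + a \<and> v \<noteq> 0)" for u \<sigma>
  have uniq: "\<sigma> = \<tau>" if bad: "bad u \<sigma>" "bad u \<tau>" for u \<sigma> \<tau>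
  proof (rule ccontr)
    assume ne: "\<sigma> \<noteq> \<tau>"
    obtain v a where va: "v \<in> span_pattern \<sigma>" "a \<in> span_pattern (s u)" "q + v = p u + a" "v \<noteq> 0"
      using bad(1) unfolding bad_def by blast
    obtain w b where wb: "w \<in> span_pattern \<tau>" "b \<in> span_pattern (s u)" "q + w = p u + b"
      using bad(2) unfolding bad_def by blast
    have "v - w = a - b" using va(3) wb(3) by linarith
    then show False
      using span_pattern_independent[OF ne _ va(1) wb(1) va(2) wb(2)] bad(1) va(4)
      unfolding bad_def by blast
  qed
  \<comment> \<open>The excluded parameters, fewer than continuum many. Where no bad parameter
    exists, \<open>THE\<close> gives an arbitrary value, which at most enlarges this set.\<close>
  let ?B = "s ` I \<union> (\<lambda>u. THE \<sigma>. bad u \<sigma>) ` I"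
  have "|?B| <o |UNIV :: real set|"
    by (intro card_of_Un_ordLess_infinite infinite_UNIV_char_0
        ordLeq_ordLess_trans[OF card_of_image I])
  then have "?B \<noteq> UNIV" using ordLess_irreflexive by metis
  then obtain \<sigma> where \<sigma>: "\<sigma> \<notin> ?B" by blast
  have "\<not> bad u \<sigma>" if "u \<in> I" for u
  proof
    assume b: "bad u \<sigma>"
    then have "(THE \<sigma>. bad u \<sigma>) = \<sigma>" using uniq by blast
    then show False using \<sigma> that by blast
  qed
  then show ?thesis using \<sigma> unfolding bad_def by blast
qed

section \<open>Embedding a set of reals into a translate of a thin set\<close>

text \<open>Index n contributes a step at \<open>d n\<close> whose height is the sum of 10^-i over
  the positions i = \<open>to_nat (n, k, \<lfloor>real k * s\<rfloor>)\<close> for all k.\<close>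

definition jump :: "(nat \<Rightarrow> real) \<Rightarrow> real \<Rightarrow> real \<Rightarrow> real" where
  "jump d s x = dec (pattern s (\<lambda>n. of_bool (d n < x)))"

lemma jump_in_cantor10: "jump d s x \<in> cantor10"
  unfolding jump_def cantor10_def
  by (intro imageI) (auto simp: pattern_def split: prod.splits)

lemma jump_diff_eq:
  "jump d s x - jump d s y = dec (pattern s (\<lambda>n. of_bool (d n < x) - of_bool (d n < y)))"
proof -
  have "\<bar>pattern s (\<lambda>n. of_bool (d n < x)) i\<bar> \<le> 1" for x i
    by (rule abs_pattern_le) simp
  then have "jump d s x - jump d s y = dec (\<lambda>i. pattern s (\<lambda>n. of_bool (d n < x)) i
       - pattern s (\<lambda>n. of_bool (d n < y)) i)"
    unfolding jump_def by (intro dec_diff[symmetric])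
  also have "(\<lambda>i. pattern s (\<lambda>n. of_bool (d n < x)) i - pattern s (\<lambda>n. of_bool (d n < y)) i)
      = pattern s (\<lambda>n. of_bool (d n < x) - of_bool (d n < y))"
    by (auto simp: pattern_def fun_eq_iff split: prod.splits)
  finally show ?thesis .
qed

lemma jump_diff_in_span_pattern: "jump d s x - jump d s y \<in> span_pattern s"
  unfolding jump_diff_eq span_pattern_def by (force simp: of_bool_def)

text \<open>The position with k = 0 belongs to every pattern, so crossing \<open>d n\<close> gains
  at least its weight, whatever s is; the other digits of the difference are nonnegative.\<close>

lemma jump_gap:
  assumes "x \<le> d n" "d n < y"
  shows "jump d s x + 1 / 10 ^ to_nat (n, 0::nat, 0::int) \<le> jump d s y"
proof -
  define \<epsilon> where "\<epsilon> = pattern s (\<lambda>n. of_bool (d n < y) - of_bool (d n < x))"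
  have b: "0 \<le> \<epsilon> i \<and> \<epsilon> i \<le> 1" for i
    unfolding \<epsilon>_def using assms by (auto simp: pattern_def split: prod.splits)
  have S: "summable (\<lambda>i. of_int (\<epsilon> i) / 10 ^ i :: real)"
    by (rule summable_dec[where B = 1]) (use b in auto)
  have nn: "0 \<le> (of_int (\<epsilon> i) / 10 ^ i :: real)" for i using b[of i] by simp
  have D: "jump d s y - jump d s x = (\<Sum>i. of_int (\<epsilon> i) / 10 ^ i)"
    unfolding jump_diff_eq \<epsilon>_def dec_def ..
  have "\<epsilon> (to_nat (n, 0::nat, 0::int)) = 1" using assms by (simp add: \<epsilon>_def)
  moreover have "of_int (\<epsilon> (to_nat (n, 0::nat, 0::int))) / 10 ^ to_nat (n, 0::nat, 0::int)
      \<le> (\<Sum>i. of_int (\<epsilon> i) / 10 ^ i :: real)"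
    using sum_le_suminf[OF S, of "{to_nat (n, 0::nat, 0::int)}"] nn by simp
  ultimately show "jump d s x + 1 / 10 ^ to_nat (n, 0::nat, 0::int) \<le> jump d s y"
    using D by simp
qed

lemma strict_mono_jump:
  assumes dense: "\<And>a b. a < b \<Longrightarrow> \<exists>n. a < d n \<and> d n < b"
  shows "strict_mono (jump d s)"
proof (rule strict_monoI)
  fix x y :: real assume "x < y"
  then obtain n where "x < d n" "d n < y" using dense by blast
  then have "jump d s x + 1 / 10 ^ to_nat (n, 0::nat, 0::int) \<le> jump d s y"
    by (intro jump_gap) auto
  moreover have "(0::real) < 1 / 10 ^ to_nat (n, 0::nat, 0::int)" by simp
  ultimately show "jump d s x < jump d s y" by linarith
qed

text \<open>Off the jump points every digit is locally constant, and the series converges uniformly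
  by comparison with a geometric series.\<close>

lemma continuous_on_jump:
  assumes "range d \<inter> S = {}"
  shows "continuous_on S (jump d s)"
proof -
  have step: "continuous_on S (\<lambda>x. of_int (pattern s (\<lambda>n. of_bool (d n < x)) i) :: real)" for i
  proof -
    obtain n k z where i: "from_nat i = (n::nat, k::nat, z::int)" by (metis prod_cases3)
    have "S \<subseteq> {..<d n} \<union> {d n<..}" using assms by force
    moreover have "continuous_on ({..<d n} \<union> {d n<..}) (\<lambda>x. of_int (of_bool (d n < x)) :: real)"
    proof (rule continuous_on_open_Un)
      show "continuous_on {..<d n} (\<lambda>x. of_int (of_bool (d n < x)) :: real)"
        by (rule continuous_on_eq[OF continuous_on_const[of _ 0]]) auto
      show "continuous_on {d n<..} (\<lambda>x. of_int (of_bool (d n < x)) :: real)"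
        by (rule continuous_on_eq[OF continuous_on_const[of _ 1]]) auto
    qed auto
    ultimately have "continuous_on S (\<lambda>x. of_int (of_bool (d n < x)) :: real)"
      using continuous_on_subset by blast
    then show ?thesis
      by (cases "z = \<lfloor>real k * s\<rfloor>") (simp_all add: pattern_def i)
  qed
  have "uniform_limit S (\<lambda>m x. \<Sum>i<m. of_int (pattern s (\<lambda>n. of_bool (d n < x)) i) / 10 ^ i)
      (\<lambda>x. \<Sum>i. of_int (pattern s (\<lambda>n. of_bool (d n < x)) i) / 10 ^ i :: real) sequentially"
  proof (rule Weierstrass_m_test[OF _ summable_const_div_power10[of 1]])
    fix i x
    have "\<bar>pattern s (\<lambda>n. of_bool (d n < x)) i\<bar> \<le> 1" by (rule abs_pattern_le) simp
    then show "norm (of_int (pattern s (\<lambda>n. of_bool (d n < x)) i) / 10 ^ i :: real) \<le> 1 / 10 ^ i"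
      by (simp add: divide_right_mono flip: of_int_abs)
  qed
  then have "continuous_on S
      (\<lambda>x. \<Sum>i. of_int (pattern s (\<lambda>n. of_bool (d n < x)) i) / 10 ^ i :: real)"
    by (rule uniform_limit_theorem[rotated])
       (auto intro!: always_eventually continuous_intros step)
  then show ?thesis unfolding jump_def dec_def .
qed

text \<open>Jump points within e of x on either side cause gaps in the values, so a value close to
  \<open>jump d s x\<close> can only come from a point within e of x.\<close>

lemma continuous_on_inv_jump:
  assumes dense: "\<And>a b. a < b \<Longrightarrow> \<exists>n. a < d n \<and> d n < b"
  shows "continuous_on (jump d s ` S) (inv (jump d s))"
  unfolding continuous_on_iff
proof (intro ballI allI impI)
  fix y and e :: real assume "y \<in> jump d s ` S" "0 < e"
  then obtain x where x: "y = jump d s x" by blast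
  have inv: "inv (jump d s) (jump d s x) = x" for x
    using strict_mono_jump[OF dense] by (simp add: strict_mono_imp_inj_on)
  obtain m where m: "x - e < d m" "d m < x" using dense[of "x - e" x] \<open>0 < e\<close> by auto
  obtain n where n: "x < d n" "d n < x + e" using dense[of x "x + e"] \<open>0 < e\<close> by auto
  let ?w = "\<lambda>n. 1 / 10 ^ to_nat (n, 0::nat, 0::int) :: real"
  show "\<exists>\<delta>>0. \<forall>y'\<in>jump d s ` S. dist y' y < \<delta> \<longrightarrow> dist (inv (jump d s) y') (inv (jump d s) y) < e"
  proof (intro exI conjI ballI impI)
    show "0 < min (?w m) (?w n)" by simp
    fix y' assume "y' \<in> jump d s ` S" and near: "dist y' y < min (?w m) (?w n)"
    then obtain x' where x': "y' = jump d s x'" by blast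
    have "x - e < x'"
    proof (rule ccontr)
      assume "\<not> x - e < x'"
      then have "jump d s x' + ?w m \<le> jump d s x" using m by (intro jump_gap) auto
      then show False using near unfolding x x' dist_real_def by linarith
    qed
    moreover have "x' < x + e"
    proof (rule ccontr)
      assume "\<not> x' < x + e"
      then have "jump d s x + ?w n \<le> jump d s x'" using n by (intro jump_gap) auto
      then show False using near unfolding x x' dist_real_def by linarith
    qed
    ultimately show "dist (inv (jump d s) y') (inv (jump d s) y) < e"
      unfolding x x' inv dist_real_def by linarith
  qed
qed

lemma homeomorphism_jump:
  assumes "\<And>a b. a < b \<Longrightarrow> \<exists>n. a < d n \<and> d n < b" "range d \<inter> S = {}"
  shows "homeomorphism S ((\<lambda>x. c + jump d s x) ` S) (\<lambda>x. c + jump d s x) (\<lambda>y. inv (jump d s) (y - c))"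
proof -
  have inv: "inv (jump d s) (jump d s x) = x" for x
    using strict_mono_jump[OF assms(1)] by (simp add: strict_mono_imp_inj_on)
  have "continuous_on ((\<lambda>x. c + jump d s x) ` S) (\<lambda>y. inv (jump d s) (y - c))"
    by (rule continuous_on_compose2[OF continuous_on_inv_jump[OF assms(1), of s S]])
       (auto intro!: continuous_intros)
  then show ?thesis
    unfolding homeomorphism_def
    by (auto simp: inv image_image intro!: continuous_intros continuous_on_jump assms(2))
qed

text \<open>A nonempty open interval inside S would lie in a single component. So a totally
  disconnected S has a dense complement, and the sequence enumerates a countable dense subset of
  it.\<close>

lemma dense_sequence:
  obtains d :: "nat \<Rightarrow> real" where "\<And>a b. a < b \<Longrightarrow> \<exists>n. a < d n \<and> d n < b"
    and "totally_disconnected S \<Longrightarrow> range d \<inter> S = {}"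
proof -
  define C where "C = (if totally_disconnected S then - S else UNIV)"
  have C: "\<exists>c\<in>C. a < c \<and> c < b" if "a < b" for a b
  proof (cases "totally_disconnected S")
    case True
    show ?thesis
    proof (rule ccontr)
      assume "\<not> ?thesis"
      then have sub: "{a<..<b} \<subseteq> S" using True by (auto simp: C_def)
      obtain x where x: "a < x" "x < b" using \<open>a < b\<close> dense by blast
      obtain y where y: "x < y" "y < b" using x dense by blast
      have "{a<..<b} \<subseteq> connected_component_set S x"
        by (rule connected_component_maximal) (use sub x in auto)
      then have "y \<in> connected_component_set S x" using x y by (meson greaterThanLessThan_iff less_trans subsetD)
      then show False using True sub x y unfolding totally_disconnected_def by force
    qed
  next
    case False
    then show ?thesis using dense[OF that] by (auto simp: C_def)
  qed
  obtain T where T: "countable T" "T \<subseteq> C" "C \<subseteq> closure T" using separable by blast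
  have TD: "\<exists>x\<in>T. a < x \<and> x < b" if ab: "a < b" for a b
  proof -
    obtain c where c: "c \<in> C" "a < c" "c < b" using C[OF ab] by blast
    then have "{a<..<b} \<inter> T \<noteq> {}"
      using T(3) by (subst open_Int_closure_eq_empty[symmetric]) auto
    then show ?thesis by auto
  qed
  have "T \<noteq> {}" using TD[of 0 1] by auto
  then have R: "range (from_nat_into T) = T" using T(1) by (rule range_from_nat_into)
  show ?thesis
  proof
    show "\<exists>n. a < from_nat_into T n \<and> from_nat_into T n < b" if "a < b" for a b
      using TD[OF that] R by (metis imageE)
    show "range (from_nat_into T) \<inter> S = {}" if "totally_disconnected S"
      using that T(2) R by (auto simp: C_def)
  qed
qed

section \<open>The transfinite construction\<close>

text \<open>Along a well-order of the reals in which every initial segment has fewer than continuum many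
  elements, the set \<open>Y t\<close> is placed so as to contain \<open>t\<close>, unless \<open>t\<close> is already covered.\<close>
lemma transfinite_placement:
  includes cardinal_syntax
  fixes G :: "real \<Rightarrow> real \<Rightarrow> real set"
  assumes G: "\<And>t s. G t s \<subseteq> span_pattern s" and G0: "\<And>t s. 0 \<in> G t s"
  obtains p s :: "real \<Rightarrow> real" where
    "\<And>t u. t \<noteq> u \<Longrightarrow> (+) (p t) ` G t (s t) \<inter> (+) (p u) ` G u (s u) = {}"
    "(\<Union>t. (+) (p t) ` G t (s t)) = UNIV"
proof -
  let ?r = "|UNIV :: real set|"
  define R where "R = ?r - Id"
  have wo: "Well_order ?r" by (rule card_of_Well_order)
  have wf: "wf R" unfolding R_def using wo by (auto simp: well_order_on_def)
  have total: "(t, u) \<in> R \<or> (u, t) \<in> R" if "t \<noteq> u" for t u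
    using wo that unfolding R_def well_order_on_def linear_order_on_def total_on_def
    by (auto simp: Field_card_of)
  have small: "|{u. (u, t) \<in> R}| <o ?r" for t
  proof -
    have "{u. (u, t) \<in> R} = underS ?r t" by (auto simp: R_def underS_def)
    then show ?thesis using card_of_underS[OF card_of_Card_order, of t UNIV] by (simp add: Field_card_of)
  qed
  define Y where "Y f u = (+) (fst (f u)) ` G u (snd (f u))" for f :: "real \<Rightarrow> real \<times> real" and u
  \<comment> \<open>The pair w holds the translation and the parameter chosen at stage t: the
    translation is uncovered, and equals t unless t is covered; the parameter is fresh as in
    \<open>fresh_parameter\<close>.\<close>
  define P where "P f t w \<longleftrightarrow> t \<in> insert (fst w) (\<Union>u\<in>{u. (u, t) \<in> R}. Y f u) \<and>
      (\<forall>u\<in>{u. (u, t) \<in> R}. fst w \<notin> Y f u \<and> (\<forall>v\<in>span_pattern (snd w).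
         \<forall>a\<in>span_pattern (snd (f u)). fst w + v = fst (f u) + a \<longrightarrow> v = 0))"
    for f :: "real \<Rightarrow> real \<times> real" and t w
  have "\<exists>f. \<forall>t. P f t (f t)"
  proof (rule dependent_wf_choice[OF wf])
    show "P f t w = P g t w" if "\<And>u. (u, t) \<in> R \<Longrightarrow> f u = g u" for f g t w
      using that by (simp add: P_def Y_def cong: conj_cong)
    fix t and f :: "real \<Rightarrow> real \<times> real"
    let ?U = "\<Union>u\<in>{u. (u, t) \<in> R}. Y f u"
    have "\<exists>q. t \<in> insert q ?U \<and> q \<notin> ?U"
    proof (cases "t \<in> ?U")
      case True
      \<comment> \<open>Here another uncovered point is needed. With \<sigma> fresh for the point 0,
        any nonzero v in \<open>span_pattern \<sigma>\<close> avoids all earlier sets.\<close>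
      obtain \<sigma> where \<sigma>: "\<forall>u\<in>{u. (u, t) \<in> R}. \<forall>v\<in>span_pattern \<sigma>.
          \<forall>a\<in>span_pattern (snd (f u)). 0 + v = fst (f u) + a \<longrightarrow> v = 0"
        using fresh_parameter[OF small, where p = "\<lambda>u. fst (f u)" and s = "\<lambda>u. snd (f u)"] by blast
      obtain v where v: "v \<in> span_pattern \<sigma>" "v \<noteq> 0" using span_pattern_nonzero by blast
      have "v \<notin> ?U"
      proof
        assume "v \<in> ?U"
        then obtain u where u: "(u, t) \<in> R" "v \<in> Y f u" by blast
        then obtain a where "a \<in> span_pattern (snd (f u))" "v = fst (f u) + a"
          unfolding Y_def using G by blast
        then show False using \<sigma> u(1) v by simp
      qed
      then show ?thesis using True by blast
    qed blast
    then obtain q where q: "t \<in> insert q ?U" "q \<notin> ?U" by blast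
    obtain \<sigma> where "\<forall>u\<in>{u. (u, t) \<in> R}. \<forall>v\<in>span_pattern \<sigma>.
        \<forall>a\<in>span_pattern (snd (f u)). q + v = fst (f u) + a \<longrightarrow> v = 0"
      using fresh_parameter[OF small, where p = "\<lambda>u. fst (f u)" and s = "\<lambda>u. snd (f u)"] by blast
    then have "P f t (q, \<sigma>)" unfolding P_def using q by simp
    then show "\<exists>w. P f t w" by blast
  qed
  then obtain f where f: "\<And>t. P f t (f t)" by blast
  have disj: "Y f t \<inter> Y f u = {}" if ut: "(u, t) \<in> R" for t u
  proof (rule ccontr)
    assume "Y f t \<inter> Y f u \<noteq> {}"
    then obtain y where y: "y \<in> Y f t" "y \<in> Y f u" by blast
    obtain v where v: "v \<in> G t (snd (f t))" "y = fst (f t) + v"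
      using y(1) unfolding Y_def by blast
    obtain a where a: "a \<in> G u (snd (f u))" "y = fst (f u) + a"
      using y(2) unfolding Y_def by blast
    have "\<forall>v\<in>span_pattern (snd (f t)). \<forall>a\<in>span_pattern (snd (f u)).
        fst (f t) + v = fst (f u) + a \<longrightarrow> v = 0"
      using f[of t] ut unfolding P_def by blast
    moreover have "v \<in> span_pattern (snd (f t))" "a \<in> span_pattern (snd (f u))"
      using v(1) a(1) G by blast+
    \<comment> \<open>A common point must therefore be \<open>fst (f t)\<close> itself, which was
      chosen uncovered.\<close>
    ultimately have "v = 0" using v(2) a(2) by metis
    then have "fst (f t) \<in> Y f u" using v(2) y(2) by simp
    then show False using f[of t] ut unfolding P_def by blast
  qed
  show ?thesis
  proof
    show "(+) ((fst \<circ> f) t) ` G t ((snd \<circ> f) t) \<inter> (+) ((fst \<circ> f) u) ` G u ((snd \<circ> f) u) = {}"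
      if "t \<noteq> u" for t u
      using total[OF that] disj[of t u] disj[of u t] unfolding Y_def by auto
    have "t \<in> (\<Union>t. Y f t)" for t
    proof -
      have "fst (f t) \<in> Y f t" unfolding Y_def using G0 by (force intro: image_eqI[of _ _ 0])
      then show ?thesis using f[of t] unfolding P_def by blast
    qed
    then show "(\<Union>t. (+) ((fst \<circ> f) t) ` G t ((snd \<circ> f) t)) = UNIV"
      unfolding Y_def by auto
  qed
qed

theorem theorem1:
  fixes X :: "real \<Rightarrow> real set"
  assumes "\<And>t. X t \<noteq> {}"
  shows "\<exists>Y :: real \<Rightarrow> real set.
           (\<forall>t. nowhere_dense (Y t) \<and> Y t \<in> null_sets lebesgue) \<and>
           (\<forall>s t. s \<noteq> t \<longrightarrow> Y s \<inter> Y t = {}) \<and>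
           (\<Union>t. Y t) = UNIV \<and>
           partition_on UNIV (range Y) \<and>
           (\<forall>t. \<exists>\<phi> :: real \<Rightarrow> real.
              bij_betw \<phi> (X t) (Y t) \<and> strict_mono_on (X t) \<phi> \<and>
              (totally_disconnected (X t) \<longrightarrow> (\<exists>\<psi>. homeomorphism (X t) (Y t) \<phi> \<psi>)))"
proof -
  have "\<forall>t. \<exists>d :: nat \<Rightarrow> real. (\<forall>a b. a < b \<longrightarrow> (\<exists>n. a < d n \<and> d n < b)) \<and>
      (totally_disconnected (X t) \<longrightarrow> range d \<inter> X t = {})"
    using dense_sequence by metis
  then obtain d :: "real \<Rightarrow> nat \<Rightarrow> real" where
    dense: "\<And>t a b. a < b \<Longrightarrow> \<exists>n. a < d t n \<and> d t n < b" and
    off: "\<And>t. totally_disconnected (X t) \<Longrightarrow> range (d t) \<inter> X t = {}"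
    by metis
  define x0 where "x0 t = (SOME x. x \<in> X t)" for t
  have x0: "x0 t \<in> X t" for t unfolding x0_def using assms by (simp add: some_in_eq)
  \<comment> \<open>Subtracting the value at a base point puts 0 into the set and turns its elements
    into differences of jump values.\<close>
  define G where "G t s = (\<lambda>x. jump (d t) s x - jump (d t) s (x0 t)) ` X t" for t s
  have G: "G t s \<subseteq> span_pattern s" "0 \<in> G t s" for t s
    unfolding G_def using jump_diff_in_span_pattern x0 by (auto intro!: image_eqI[of _ _ "x0 t"])
  obtain p s :: "real \<Rightarrow> real" where
    disj: "\<And>t u. t \<noteq> u \<Longrightarrow> (+) (p t) ` G t (s t) \<inter> (+) (p u) ` G u (s u) = {}" and
    cover: "(\<Union>t. (+) (p t) ` G t (s t)) = UNIV"
    by (rule transfinite_placement[of G, OF G]) (rule that)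
  \<comment> \<open>This constant absorbs the base value, so the placed set is the image of
    \<open>X t\<close> under a translated jump function.\<close>
  define c where "c t = p t - jump (d t) (s t) (x0 t)" for t
  define \<phi> where "\<phi> t x = c t + jump (d t) (s t) x" for t x
  define Y where "Y t = \<phi> t ` X t" for t
  have Y_eq: "Y t = (+) (p t) ` G t (s t)" for t
    unfolding Y_def \<phi>_def G_def c_def image_image by (simp add: algebra_simps)
  have mono: "strict_mono (\<phi> t)" for t
    using strict_mono_jump[OF dense, of t "s t"] by (auto simp: \<phi>_def strict_mono_def)
  have "Y t \<subseteq> (+) (c t) ` cantor10" for t
    unfolding Y_def \<phi>_def using jump_in_cantor10 by blast
  note thin = translate_subset_cantor10[OF this]
  have Ydisj: "Y t \<inter> Y u = {}" if "t \<noteq> u" for t u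
    using disj[OF that] by (simp add: Y_eq)
  have Ycover: "(\<Union>t. Y t) = UNIV" using cover by (simp add: Y_eq)
  have "partition_on UNIV (range Y)"
  proof (rule partition_onI)
    show "disjnt A B" if "A \<in> range Y" "B \<in> range Y" "A \<noteq> B" for A B
      using that Ydisj unfolding disjnt_def by (metis imageE)
    show "{} \<notin> range Y"
      using assms by (auto simp: Y_def)
  qed (use Ycover in auto)
  moreover have "\<exists>\<phi>. bij_betw \<phi> (X t) (Y t) \<and> strict_mono_on (X t) \<phi> \<and>
      (totally_disconnected (X t) \<longrightarrow> (\<exists>\<psi>. homeomorphism (X t) (Y t) \<phi> \<psi>))" for t
  proof (rule exI[of _ "\<phi> t"], intro conjI impI)
    show "bij_betw (\<phi> t) (X t) (Y t)"
      unfolding Y_def using mono[of t] by (simp add: bij_betw_def strict_mono_imp_inj_on inj_on_subset)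
    show "strict_mono_on (X t) (\<phi> t)"
      using mono[of t] by (auto simp: strict_mono_on_def strict_mono_def)
    show "\<exists>\<psi>. homeomorphism (X t) (Y t) (\<phi> t) \<psi>" if "totally_disconnected (X t)"
      unfolding Y_def \<phi>_def using homeomorphism_jump[OF dense off[OF that]] by blast
  qed
  ultimately show ?thesis
    using thin Ydisj Ycover by (intro exI[where x = Y] conjI allI impI)
qed

end
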